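(* Consider a Bernoulli stopping problem with independent Bernoulli trials $(X_k)_{k\ge1}$, success probabilities $p_k=\mathbb{P}(X_k=1)\in(0,1)$ satisfying $\sum_k p_k<\infty$, and a nonnegative bounded stopping reward sequence $f$ with $f_\infty=0$. If $f$ is quasi-unimodal, then the stopping problem is monotone.
   Context: Let $S=\{0,1,2,\dots,\infty\}$ with its natural order and $f=(f_k)_{k\in S}$ with $f_0=0$. In the Bernoulli stopping problem one observes the trials one by one; on a success at trial $k$ one may stop and receive $f_k$, or continue; never stopping yields $f_\infty$. With $q_k=1-p_k$, let $P(i,j)=p_j\prod_{k=i+1}^{j-1}q_k$ for $i<j<\infty$ (empty product $=1$). The continuation payoff is $g_k=\sum_{j>k,\ j<\infty}P(k,j)f_j$ for finite $k$ (recall $f_\infty=0$), the expected payoff of skipping the first $k$ trials and stopping at the first later success, if any. A real sequence $u$ is quasi-unimodal if for every $\lambda\in\mathbb{R}$ the sequence $u-\lambda$ has at most two sign changes (counted after deleting zero terms) and, whenever exactly two occur, the sign pattern is $-,+,-$. The problem is monotone if the condition under which the myopic rule $\tau=\min\{j\ge1: X_j=1,\ f_j\ge g_j\}$ stops is absorbing: for every $k\in\mathbb{N}$, $f_k\ge g_k$ implies $f_{k+1}\ge g_{k+1}$. *)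

theory Defs
  imports "HOL-Probability.Probability"
begin

text \<open>
  Trials are indexed from 1; the values of \<open>X\<close> and \<open>p\<close> at 0 are irrelevant. The reward is
  indexed by \<^typ>\<open>enat\<close>, which is \<open>{0, 1, 2, \<dots>, \<infinity>}\<close> with its natural order.
\<close>

locale bernoulli_stopping_problem = prob_space M
  for M :: "'w measure" +
  fixes X :: "nat \<Rightarrow> 'w \<Rightarrow> bool"
    and p :: "nat \<Rightarrow> real"
    and f :: "enat \<Rightarrow> real"
  assumes indep_trials: "indep_vars (\<lambda>_. count_space UNIV) X {1..}"
    and success_prob: "\<And>k. k \<ge> 1 \<Longrightarrow> p k = prob {\<omega> \<in> space M. X k \<omega>}"
    and reward_0: "f 0 = 0"

text \<open>Probability that the first success after trial \<open>i\<close> is at trial \<open>j\<close>, for \<open>i < j\<close>.\<close>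

definition first_success_prob :: "(nat \<Rightarrow> real) \<Rightarrow> nat \<Rightarrow> nat \<Rightarrow> real" where
  "first_success_prob p i j = p j * (\<Prod>k\<in>{i<..<j}. 1 - p k)"

text \<open>The term for \<open>j = \<infinity>\<close> is absent, so this is the continuation payoff only when \<open>f \<infinity> = 0\<close>.\<close>

definition continuation_payoff :: "(nat \<Rightarrow> real) \<Rightarrow> (enat \<Rightarrow> real) \<Rightarrow> nat \<Rightarrow> real" where
  "continuation_payoff p f k = (\<Sum>\<^sub>\<infinity>j\<in>{k<..}. first_success_prob p k j * f (enat j))"

definition monotone_stopping_problem :: "(nat \<Rightarrow> real) \<Rightarrow> (enat \<Rightarrow> real) \<Rightarrow> bool" where
  "monotone_stopping_problem p f \<longleftrightarrow>
     (\<forall>k::nat. f (enat k) \<ge> continuation_payoff p f k \<longrightarrow>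
        f (enat (Suc k)) \<ge> continuation_payoff p f (Suc k))"

text \<open>
  The number of sign changes is the supremum of the lengths of finite alternating subsequences.
  Zero terms never occur in such a subsequence, and the definition also makes sense for index
  sets such as \<^typ>\<open>enat\<close>, where the last index has no predecessor.
\<close>

definition sign_changes :: "('i::linorder \<Rightarrow> real) \<Rightarrow> enat" where
  "sign_changes u = Sup {enat n |n. \<exists>i :: nat \<Rightarrow> 'i.
     strict_mono_on {..n} i \<and> (\<forall>m<n. u (i m) * u (i (Suc m)) < 0)}"

text \<open>
  If there are exactly two sign changes, all alternating subsequences of three terms start with
  the same sign, so the sign pattern is determined by any one of them.
\<close>

definition quasi_unimodal :: "('i::linorder \<Rightarrow> real) \<Rightarrow> bool" where
  "quasi_unimodal u \<longleftrightarrow> (\<forall>l::real.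
     sign_changes (\<lambda>k. u k - l) \<le> 2 \<and>
     (sign_changes (\<lambda>k. u k - l) = 2 \<longrightarrow>
        (\<exists>a b c. a < b \<and> b < c \<and> u a - l < 0 \<and> u b - l > 0 \<and> u c - l < 0)))"

end

theory Submission
  imports Defs
begin

text \<open>
  As \<open>f\<close> starts at its minimum 0, quasi-unimodality forbids a dip \<open>f a > f b < f c\<close> with
  \<open>a < b < c\<close>. The continuation payoff \<open>g\<close> satisfies
  \<open>g k = p (k + 1) * f (k + 1) + (1 - p (k + 1)) * g (k + 1)\<close>. If \<open>f k \<ge> g k\<close> but
  \<open>f (k + 1) < g (k + 1)\<close>, then this convex combination gives \<open>f k \<ge> g k > f (k + 1)\<close>, while
  some later \<open>f j\<close> exceeds \<open>f (k + 1)\<close> because \<open>g (k + 1)\<close> is a subconvex combination of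
  these values: a dip at \<open>k + 1\<close>.
\<close>

text \<open>If both \<open>u a\<close> and \<open>u c\<close> exceeded \<open>u b\<close>, a level
  \<open>l\<close> slightly above \<open>u b\<close> would give \<open>u - l\<close> the signs -, +,
  -, + at \<open>z\<close>, \<open>a\<close>, \<open>b\<close>, \<open>c\<close>: three sign
  changes.\<close>

lemma quasi_unimodal_no_dip:
  fixes u :: "'i::linorder \<Rightarrow> real"
  assumes "quasi_unimodal u" and ord: "z < a" "a < b" "b < c" and "u z \<le> u b"
  shows "min (u a) (u c) \<le> u b"
proof (rule ccontr)
  assume "\<not> min (u a) (u c) \<le> u b"
  then obtain l where l: "u b < l" "l < min (u a) (u c)"
    by (meson dense not_le)
  define i where "i m = (if m = 0 then z else if m = 1 then a else if m = 2 then b else c)"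
    for m :: nat
  have neg: "s * t < 0" if "s < 0 \<and> t > 0 \<or> s > 0 \<and> t < 0" for s t :: real
    using that by (auto simp: mult_less_0_iff)
  have "strict_mono_on {..3} i"
    using ord by (auto simp: strict_mono_on_def i_def)
  moreover have "(u (i m) - l) * (u (i (Suc m)) - l) < 0" if "m < 3" for m
  proof -
    have "m = 0 \<or> m = 1 \<or> m = 2" using that by auto
    then show ?thesis
      using l assms(5) by (elim disjE) (auto simp: i_def intro!: neg)
  qed
  ultimately have "enat 3 \<le> sign_changes (\<lambda>k. u k - l)"
    unfolding sign_changes_def by (intro Sup_upper) auto
  also have "\<dots> \<le> 2"
    using assms(1) by (simp add: quasi_unimodal_def)
  finally show False
    by (simp add: numeral_eq_enat)
qed

lemma first_success_prob_Suc:
  assumes "Suc k < j"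
  shows "first_success_prob p k j = (1 - p (Suc k)) * first_success_prob p (Suc k) j"
proof -
  have "{k<..<j} = insert (Suc k) {Suc k<..<j}" using assms by auto
  then show ?thesis by (simp add: first_success_prob_def)
qed

text \<open>The first successes at different trials are disjoint events; together they are the
  complement of \<open>n\<close> failures in a row. Formally the sum telescopes.\<close>

lemma sum_first_success_prob:
  "(\<Sum>j\<in>{k<..k+n}. first_success_prob p k j) = 1 - (\<Prod>j\<in>{k<..k+n}. 1 - p j)"
proof (induction n)
  case (Suc n)
  have "{k<..k + Suc n} = insert (Suc (k+n)) {k<..k+n}" "{k<..<Suc (k+n)} = {k<..k+n}"
    by auto
  then show ?case
    using Suc by (simp add: first_success_prob_def algebra_simps)
qed simp

context
  fixes p :: "nat \<Rightarrow> real"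
  assumes p: "\<And>k. k \<ge> 1 \<Longrightarrow> 0 \<le> p k \<and> p k \<le> 1"
begin

lemma first_success_prob_nonneg: "i < j \<Longrightarrow> 0 \<le> first_success_prob p i j"
  unfolding first_success_prob_def using p by (intro mult_nonneg_nonneg prod_nonneg) auto

lemma sum_first_success_prob_le_1:
  assumes "finite F" "F \<subseteq> {k<..}"
  shows "(\<Sum>j\<in>F. first_success_prob p k j) \<le> 1"
proof -
  obtain n where "\<forall>j\<in>F. j \<le> n"
    using assms(1) finite_nat_set_iff_bounded_le by blast
  then have "F \<subseteq> {k<..k+n}"
    using assms(2) by fastforce
  then have "(\<Sum>j\<in>F. first_success_prob p k j) \<le> (\<Sum>j\<in>{k<..k+n}. first_success_prob p k j)"
    by (intro sum_mono2) (auto intro: first_success_prob_nonneg)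
  also have "\<dots> \<le> 1"
    unfolding sum_first_success_prob using p by (auto intro: prod_nonneg)
  finally show ?thesis .
qed

text \<open>The weights are nonnegative, but their total may fall short of 1;
  \<open>0 \<le> c\<close> makes up for the missing mass.\<close>

lemma sum_first_success_prob_mult_le:
  assumes "finite F" "F \<subseteq> {k<..}" and "0 \<le> c" and "\<And>j. k < j \<Longrightarrow> u j \<le> c"
  shows "(\<Sum>j\<in>F. first_success_prob p k j * u j) \<le> c"
proof -
  have "(\<Sum>j\<in>F. first_success_prob p k j * u j) \<le> (\<Sum>j\<in>F. first_success_prob p k j * c)"
    using assms by (intro sum_mono mult_left_mono) (auto intro: first_success_prob_nonneg)
  also have "\<dots> \<le> c"
    using mult_right_mono[OF sum_first_success_prob_le_1[OF assms(1,2)] \<open>0 \<le> c\<close>]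
    by (simp add: sum_distrib_right)
  finally show ?thesis .
qed

context
  fixes f :: "enat \<Rightarrow> real"
  assumes nonneg: "\<And>k. 0 \<le> f k" and bounded: "bounded (range f)"
begin

lemma first_success_prob_mult_summable_on:
  "(\<lambda>j. first_success_prob p k j * f (enat j)) summable_on {k<..}"
proof -
  obtain B where B: "\<And>k. f k \<le> B"
    using bounded by (auto simp: bounded_iff abs_le_iff)
  have "0 \<le> B" using nonneg B order_trans by blast
  show ?thesis
  proof (rule nonneg_bdd_above_summable_on)
    show "bdd_above (sum (\<lambda>j. first_success_prob p k j * f (enat j)) ` {F. F \<subseteq> {k<..} \<and> finite F})"
      using B \<open>0 \<le> B\<close> by (intro bdd_aboveI[where M=B]) (auto intro: sum_first_success_prob_mult_le)
  qed (auto intro: mult_nonneg_nonneg first_success_prob_nonneg nonneg)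
qed

lemma continuation_payoff_le:
  assumes "0 \<le> c" and "\<And>j. k < j \<Longrightarrow> f (enat j) \<le> c"
  shows "continuation_payoff p f k \<le> c"
  unfolding continuation_payoff_def
  using first_success_prob_mult_summable_on assms
  by (intro infsum_le_finite_sums) (auto intro: sum_first_success_prob_mult_le)

text \<open>Condition on trial \<open>Suc k\<close>: a success ends the search with its reward, a
  failure multiplies every later weight by \<open>1 - p (Suc k)\<close> and leaves the same problem
  started one trial later.\<close>

lemma continuation_payoff_Suc:
  "continuation_payoff p f k =
     p (Suc k) * f (enat (Suc k)) + (1 - p (Suc k)) * continuation_payoff p f (Suc k)"
proof -
  let ?t = "\<lambda>k j. first_success_prob p k j * f (enat j)"
  have split: "{k<..} = {Suc k} \<union> {Suc k<..}" by auto
  have "?t k summable_on {Suc k<..}"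
    by (rule summable_on_subset[OF first_success_prob_mult_summable_on]) auto
  then have "infsum (?t k) {k<..} = ?t k (Suc k) + infsum (?t k) {Suc k<..}"
    unfolding split by (subst infsum_Un_disjoint) auto
  also have "infsum (?t k) {Suc k<..} = (\<Sum>\<^sub>\<infinity>j\<in>{Suc k<..}. (1 - p (Suc k)) * ?t (Suc k) j)"
    by (intro infsum_cong) (simp add: first_success_prob_Suc)
  also have "\<dots> = (1 - p (Suc k)) * infsum (?t (Suc k)) {Suc k<..}"
    by (rule infsum_cmult_right')
  also have "{k<..<Suc k} = {}" by auto
  then have "?t k (Suc k) = p (Suc k) * f (enat (Suc k))"
    by (simp add: first_success_prob_def)
  finally show ?thesis
    by (simp add: continuation_payoff_def)
qed

end

end

theorem theorem10:
  fixes M :: "'w measure" and X :: "nat \<Rightarrow> 'w \<Rightarrow> bool"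
    and p :: "nat \<Rightarrow> real" and f :: "enat \<Rightarrow> real"
  assumes "bernoulli_stopping_problem M X p f"
    and "\<And>k. k \<ge> 1 \<Longrightarrow> 0 < p k \<and> p k < 1"
    and "summable (\<lambda>k. p (Suc k))"
    and "\<And>k. f k \<ge> 0"
    and "bounded (range f)"
    and "f \<infinity> = 0"
    and "quasi_unimodal f"
  shows "monotone_stopping_problem p f"
  unfolding monotone_stopping_problem_def
proof (intro allI impI)
  fix k :: nat
  let ?g = "continuation_payoff p f" and ?k' = "Suc k"
  assume stop: "?g k \<le> f (enat k)"
  have p: "0 \<le> p j \<and> p j \<le> 1" if "j \<ge> 1" for j
    using assms(2)[OF that] by simp
  have f0: "f 0 = 0"
    using assms(1) by (rule bernoulli_stopping_problem.reward_0)
  show "?g ?k' \<le> f (enat ?k')"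
  proof (rule ccontr)
    assume less: "\<not> ?g ?k' \<le> f (enat ?k')"
    \<comment> \<open>Strict because \<open>p ?k' < 1\<close>: a failure at \<open>?k'\<close> has
      positive probability.\<close>
    have "0 < (1 - p ?k') * (?g ?k' - f (enat ?k'))"
      using less assms(2)[of ?k'] by simp
    also have "\<dots> = ?g k - f (enat ?k')"
      by (subst continuation_payoff_Suc[OF p assms(4,5), where k = k]) (auto simp: algebra_simps)
    finally have down: "f (enat ?k') < f (enat k)"
      using stop by simp
    \<comment> \<open>Otherwise \<open>f (enat ?k')\<close> would bound all later rewards, hence
      also \<open>?g ?k'\<close>.\<close>
    obtain j where j: "?k' < j" "f (enat ?k') < f (enat j)"
      using continuation_payoff_le[OF p assms(4,5), where c = "f (enat ?k')" and k = ?k'] less assms(4)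
      by (meson not_le)
    \<comment> \<open>The dip at \<open>?k'\<close> between \<open>k\<close> and \<open>j\<close>
      needs a low point before \<open>k\<close>. Index 0 serves, as \<open>f 0 = 0\<close> is the
      minimum; \<open>k\<close> itself is not 0, since \<open>f\<close> drops after it.\<close>
    have "k \<noteq> 0"
      using down f0 assms(4)[of "enat ?k'"] by (cases k) (auto simp: zero_enat_def)
    then have "min (f (enat k)) (f (enat j)) \<le> f (enat ?k')"
      using j f0 assms(4)
      by (intro quasi_unimodal_no_dip[OF assms(7), of 0]) (auto simp: zero_enat_def)
    with down j show False by simp
  qed
qed

end
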